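(* Let $X=(X_1,\dots,X_n)$ be an $\mathbf{E}^n$-valued random vector with independent components, and let $\alpha=(\alpha_1,\dots,\alpha_n)\in[0,\infty)^n$ satisfy $\|\alpha\|=1$. Let $A\subset\mathbf{E}^n$ be any measurable set (such that $x\mapsto d_\alpha(x,A)$ is measurable) and put $\rho=\mathbb{E}[d_\alpha(X,A)]$. Then for every $t>0$, $$\mathbb{P}(d_\alpha(X,A)\ge t)\,\mathbb{P}(X\in A)\le e^{-h(t)},$$ where $$h(t)=\begin{cases}2\rho^2, & 0<t<\rho,\\ t^2+(t-2\rho)^2, & t\ge\rho.\end{cases}$$ In particular, for every $t>0$, $$\mathbb{P}(d_\alpha(X,A)\ge t)\,\mathbb{P}(X\in A)\le e^{-t^2},$$ and $$\mathbb{P}(X\notin A)\,\mathbb{P}(X\in A)\le e^{-2\rho^2}.$$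
   Context: $n\ge1$, $\mathbf{E}$ is a (separable) space equipped with a $\sigma$-algebra, and $\mathbf{E}^n$ carries the product $\sigma$-algebra. For $\alpha\in[0,\infty)^n$, $\|\alpha\|=(\sum_{i=1}^n\alpha_i^2)^{1/2}$. For $x,y\in\mathbf{E}^n$ the $\alpha$-Hamming distance is $d_\alpha(x,y)=\sum_{i:\,x_i\ne y_i}\alpha_i$, and for $A\subset\mathbf{E}^n$, $d_\alpha(x,A)=\inf_{y\in A}d_\alpha(x,y)$ (with $\inf\emptyset=+\infty$ and $e^{-\infty}=0$ if $A$ is empty). Standing assumption: $d_\alpha(\cdot,A)$ is measurable. *)

theory Defs
  imports "HOL-Probability.Probability"
begin

definition hamming_dist :: "nat \<Rightarrow> (nat \<Rightarrow> real) \<Rightarrow> (nat \<Rightarrow> 'e) \<Rightarrow> (nat \<Rightarrow> 'e) \<Rightarrow> real" where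
  "hamming_dist n \<alpha> x y = (\<Sum>i\<in>{i\<in>{1..n}. x i \<noteq> y i}. \<alpha> i)"

text \<open>The distance to a set is extended-valued, so that the distance to the empty set is
  \<open>\<infinity>\<close>.\<close>

definition hamming_dist_set ::
  "nat \<Rightarrow> (nat \<Rightarrow> real) \<Rightarrow> (nat \<Rightarrow> 'e) \<Rightarrow> (nat \<Rightarrow> 'e) set \<Rightarrow> ennreal" where
  "hamming_dist_set n \<alpha> x A = (INF y\<in>A. ennreal (hamming_dist n \<alpha> x y))"

text \<open>In the second branch \<open>\<rho> \<le> t\<close> is finite. The conversion to \<^typ>\<open>real\<close> makes
  \<open>t - 2 * \<rho>\<close>, which may be negative, the untruncated difference.\<close>

definition rate :: "ennreal \<Rightarrow> real \<Rightarrow> ennreal" where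
  "rate \<rho> t = (if ennreal t < \<rho> then 2 * \<rho>\<^sup>2
              else ennreal (t\<^sup>2 + (t - 2 * enn2real \<rho>)\<^sup>2))"

text \<open>The map \<open>r \<mapsto> exp (- r)\<close>, extended by the convention that
  its value at \<open>\<infinity>\<close> is \<open>0\<close>.\<close>

definition exp_neg :: "ennreal \<Rightarrow> real" where
  "exp_neg r = (if r = \<infinity> then 0 else exp (- enn2real r))"

end

theory Submission
  imports Defs
begin

text \<open>The function \<open>x \<mapsto> d\<^sub>\<alpha>(x, A)\<close> changes by at most \<open>\<alpha>\<^sub>i\<close> when the \<open>i\<close>-th coordinate is
  changed, so McDiarmid's bounded differences inequality applies to both of its tails. As the
  distance vanishes on \<open>A\<close>, the lower tail gives \<open>P(X \<in> A) \<le> exp(-2\<rho>\<^sup>2)\<close>, while for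
  \<open>t \<ge> \<rho>\<close> the upper tail gives \<open>P(d\<^sub>\<alpha>(X, A) \<ge> t) \<le> exp(-2(t - \<rho>)\<^sup>2)\<close>. The bound follows from
  \<open>2(t - \<rho>)\<^sup>2 + 2\<rho>\<^sup>2 = t\<^sup>2 + (t - 2\<rho>)\<^sup>2\<close>.\<close>

section \<open>McDiarmid's inequality\<close>

text \<open>A function of oscillation at most \<open>c\<close> takes its values in
  \<open>[a, a + c]\<close> with \<open>a\<close> its infimum, and Hoeffding's lemma for an interval
  depends only on the width. When one coordinate is integrated out below, the interval varies with
  the remaining coordinates while the width does not, hence this form.\<close>

lemma Hoeffdings_lemma_bounded_oscillation:
  fixes f :: "'a \<Rightarrow> real"
  assumes "prob_space M" and f: "f \<in> borel_measurable M" and "l > 0"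
    and osc: "\<And>x y. x \<in> space M \<Longrightarrow> y \<in> space M \<Longrightarrow> \<bar>f x - f y\<bar> \<le> c"
  shows "(\<integral>\<^sup>+x. exp (l * (f x - integral\<^sup>L M f)) \<partial>M) \<le> ennreal (exp (l\<^sup>2 * c\<^sup>2 / 8))"
proof -
  interpret prob_space M by fact
  define a where "a = (INF x\<in>space M. f x)"
  obtain z where z: "z \<in> space M"
    using not_empty by blast
  \<comment> \<open>A real infimum is a genuine lower bound only for a set bounded below; the
    oscillation bound around one point \<open>z\<close> supplies this.\<close>
  have bdd: "bdd_below (f ` space M)"
  proof (rule bdd_belowI2)
    show "f z - c \<le> f x" if "x \<in> space M" for x
      using osc[OF z that] by linarith
  qed
  have "a \<le> f x" if "x \<in> space M" for x
    unfolding a_def using bdd that by (rule cINF_lower)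
  moreover have "f x \<le> a + c" if "x \<in> space M" for x
  proof -
    have "f x - c \<le> a"
      unfolding a_def
    proof (rule cINF_greatest)
      show "f x - c \<le> f y" if "y \<in> space M" for y
        using osc[OF \<open>x \<in> space M\<close> that] by linarith
    qed (use z in auto)
    then show ?thesis by linarith
  qed
  ultimately interpret interval_bounded_random_variable M f a "a + c"
    by unfold_locales (auto intro: f)
  show ?thesis
    using Hoeffdings_lemma_nn_integral[OF \<open>l > 0\<close>] by simp
qed

text \<open>Coordinates are integrated out one at a time. With \<open>g\<close> the average of
  \<open>f\<close> over the new coordinate \<open>i\<close>, split \<open>f - E f\<close> as
  \<open>(f - g) + (g - E g)\<close>. For fixed other coordinates Hoeffding's lemma bounds the
  exponential moment of the first summand; the second falls to the induction hypothesis. The bound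
  \<open>B\<close> provides integrability.\<close>

lemma (in product_prob_space) bounded_differences_mgf:
  fixes f :: "('i \<Rightarrow> 'a) \<Rightarrow> real"
  assumes "finite I" and "l > 0"
    and "f \<in> borel_measurable (Pi\<^sub>M I M)"
    and "\<And>x. x \<in> space (Pi\<^sub>M I M) \<Longrightarrow> \<bar>f x\<bar> \<le> B"
    and "\<And>i x y. i \<in> I \<Longrightarrow> x \<in> space (Pi\<^sub>M I M) \<Longrightarrow> y \<in> space (M i) \<Longrightarrow> \<bar>f x - f (x(i := y))\<bar> \<le> c i"
  shows "(\<integral>\<^sup>+x. exp (l * (f x - integral\<^sup>L (Pi\<^sub>M I M) f)) \<partial>Pi\<^sub>M I M)
           \<le> ennreal (exp (l\<^sup>2 * (\<Sum>i\<in>I. (c i)\<^sup>2) / 8))"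
  using assms(1,3-)
proof (induction I arbitrary: f rule: finite_induct)
  case empty
  then show ?case
    by (simp add: PiM_empty nn_integral_count_space_finite lebesgue_integral_count_space_finite)
next
  case (insert i I)
  interpret iI: prob_space "Pi\<^sub>M (insert i I) M"
    by (intro prob_space_PiM prob_space)
  note f [measurable] = insert.prems(1)
  have upd: "x(i := y) \<in> space (Pi\<^sub>M (insert i I) M)"
    if "x \<in> space (Pi\<^sub>M I M)" "y \<in> space (M i)" for x y
    using that by (auto simp: space_PiM PiE_def extensional_def)
  have fupd [measurable]: "(\<lambda>y. f (x(i := y))) \<in> borel_measurable (M i)"
    if "x \<in> space (Pi\<^sub>M I M)" for x
    using that insert.hyps by measurable
  have fupd2: "(\<lambda>(x, y). f (x(i := y))) \<in> borel_measurable (Pi\<^sub>M I M \<Otimes>\<^sub>M M i)"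
    using measurable_compose[OF measurable_add_dim f] by (simp add: case_prod_unfold)
  \<comment> \<open>This is the conditional expectation of \<open>f\<close> given the coordinates in
    \<open>I\<close>.\<close>
  define g where "g = (\<lambda>x. \<integral>y. f (x(i := y)) \<partial>M i)"
  have g [measurable]: "g \<in> borel_measurable (Pi\<^sub>M I M)"
    unfolding g_def by (rule M.borel_measurable_lebesgue_integral[OF fupd2])
  have int_f: "integrable (Pi\<^sub>M (insert i I) M) f"
    by (rule iI.integrable_const_bound[where B = B]) (use insert.prems(2) in auto)
  have int_upd: "integrable (M i) (\<lambda>y. f (x(i := y)))" if x: "x \<in> space (Pi\<^sub>M I M)" for x
    by (rule M.integrable_const_bound[where B = B]) (use insert.prems(2) upd x fupd in auto)
  have gB: "\<bar>g x\<bar> \<le> B" if x: "x \<in> space (Pi\<^sub>M I M)" for x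
  proof -
    have B: "f (x(i := y)) \<le> B" "- B \<le> f (x(i := y))" if "y \<in> space (M i)" for y
      using insert.prems(2)[OF upd[OF x that]] unfolding abs_le_iff by linarith+
    have "g x \<le> (\<integral>y. B \<partial>M i)"
      unfolding g_def by (intro integral_mono int_upd x B) auto
    moreover have "(\<integral>y. - B \<partial>M i) \<le> g x"
      unfolding g_def by (intro integral_mono int_upd x B) auto
    ultimately show ?thesis by (simp add: M.prob_space)
  qed
  \<comment> \<open>Averaging preserves bounded differences: since \<open>i\<close> and
    \<open>j\<close> differ, the two updates commute, and the change of \<open>g\<close> is the mean
    of \<open>?D\<close>, whose values lie between \<open>- c j\<close> and
    \<open>c j\<close>.\<close>
  have gc: "\<bar>g x - g (x(j := y))\<bar> \<le> c j"
    if j: "j \<in> I" and x: "x \<in> space (Pi\<^sub>M I M)" and y: "y \<in> space (M j)" for j x y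
  proof -
    have ij: "i \<noteq> j" using insert.hyps j by auto
    have x': "x(j := y) \<in> space (Pi\<^sub>M I M)"
      using x y j by (auto simp: space_PiM PiE_def extensional_def)
    let ?D = "\<lambda>z. f (x(i := z)) - f (x(j := y, i := z))"
    have D: "?D z \<le> c j" "- c j \<le> ?D z" if "z \<in> space (M i)" for z
      using insert.prems(3)[OF insertI2[OF j] upd[OF x that] y]
      unfolding fun_upd_twist[OF ij] abs_le_iff by linarith+
    have intD: "integrable (M i) ?D"
      by (intro Bochner_Integration.integrable_diff int_upd x x')
    have "(\<integral>z. ?D z \<partial>M i) \<le> (\<integral>z. c j \<partial>M i)"
      by (intro integral_mono intD D) auto
    moreover have "(\<integral>z. - c j \<partial>M i) \<le> (\<integral>z. ?D z \<partial>M i)"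
      by (intro integral_mono intD D) auto
    moreover have "g x - g (x(j := y)) = (\<integral>z. ?D z \<partial>M i)"
      unfolding g_def by (intro Bochner_Integration.integral_diff [symmetric] int_upd x x')
    ultimately show ?thesis by (simp add: M.prob_space)
  qed
  \<comment> \<open>By Fubini \<open>f\<close> and \<open>g\<close> have the same mean, so the
    induction hypothesis for \<open>g\<close> is centred at the right constant.\<close>
  have Ef: "integral\<^sup>L (Pi\<^sub>M (insert i I) M) f = integral\<^sup>L (Pi\<^sub>M I M) g" (is "_ = ?m")
    unfolding g_def by (rule product_integral_insert[OF insert.hyps int_f])
  have inner: "(\<integral>\<^sup>+y. exp (l * (f (x(i := y)) - g x)) \<partial>M i) \<le> ennreal (exp (l\<^sup>2 * (c i)\<^sup>2 / 8))"
    if x: "x \<in> space (Pi\<^sub>M I M)" for x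
    unfolding g_def
  proof (rule Hoeffdings_lemma_bounded_oscillation[OF prob_space fupd[OF x] \<open>l > 0\<close>])
    show "\<bar>f (x(i := y)) - f (x(i := z))\<bar> \<le> c i" if "y \<in> space (M i)" "z \<in> space (M i)" for y z
      using insert.prems(3)[OF insertI1 upd[OF x that(1)] that(2)] by (simp only: fun_upd_upd)
  qed
  have "(\<integral>\<^sup>+x. exp (l * (f x - ?m)) \<partial>Pi\<^sub>M (insert i I) M)
        = (\<integral>\<^sup>+x. \<integral>\<^sup>+y. exp (l * (f (x(i := y)) - ?m)) \<partial>M i \<partial>Pi\<^sub>M I M)"
    by (rule product_nn_integral_insert[OF insert.hyps]) measurable
  \<comment> \<open>The factor involving \<open>g x - ?m\<close> does not depend on \<open>y\<close>
    and leaves the inner integral.\<close>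
  also have "\<dots> = (\<integral>\<^sup>+x. ennreal (exp (l * (g x - ?m)))
                     * (\<integral>\<^sup>+y. exp (l * (f (x(i := y)) - g x)) \<partial>M i) \<partial>Pi\<^sub>M I M)"
  proof (rule nn_integral_cong)
    fix x assume x: "x \<in> space (Pi\<^sub>M I M)"
    have [measurable]: "(\<lambda>y. f (x(i := y))) \<in> borel_measurable (M i)"
      by (rule fupd[OF x])
    have "(\<integral>\<^sup>+y. exp (l * (f (x(i := y)) - ?m)) \<partial>M i)
          = (\<integral>\<^sup>+y. ennreal (exp (l * (g x - ?m))) * ennreal (exp (l * (f (x(i := y)) - g x))) \<partial>M i)"
      by (intro nn_integral_cong)
         (simp add: ring_distribs flip: ennreal_mult exp_add)
    also have "\<dots> = ennreal (exp (l * (g x - ?m)))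
                     * (\<integral>\<^sup>+y. exp (l * (f (x(i := y)) - g x)) \<partial>M i)"
      by (rule nn_integral_cmult) measurable
    finally show "(\<integral>\<^sup>+y. exp (l * (f (x(i := y)) - ?m)) \<partial>M i) = \<dots>" .
  qed
  \<comment> \<open>The bound on the inner integral is uniform in \<open>x\<close>, so it comes out
    as a constant factor.\<close>
  also have "\<dots> \<le> (\<integral>\<^sup>+x. ennreal (exp (l * (g x - ?m))) * ennreal (exp (l\<^sup>2 * (c i)\<^sup>2 / 8)) \<partial>Pi\<^sub>M I M)"
    by (intro nn_integral_mono mult_left_mono inner) auto
  also have "\<dots> = (\<integral>\<^sup>+x. exp (l * (g x - ?m)) \<partial>Pi\<^sub>M I M) * ennreal (exp (l\<^sup>2 * (c i)\<^sup>2 / 8))"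
    by (rule nn_integral_multc) measurable
  also have "\<dots> \<le> ennreal (exp (l\<^sup>2 * (\<Sum>i\<in>I. (c i)\<^sup>2) / 8)) * ennreal (exp (l\<^sup>2 * (c i)\<^sup>2 / 8))"
    by (intro mult_right_mono insert.IH g gB gc) auto
  also have "\<dots> = ennreal (exp (l\<^sup>2 * (\<Sum>i\<in>insert i I. (c i)\<^sup>2) / 8))"
    using insert.hyps by (simp add: field_simps flip: ennreal_mult exp_add)
  finally show ?case
    by (simp add: Ef)
qed

text \<open>Chernoff's bound combined with the preceding estimate gives the exponent
  \<open>- l * \<epsilon> + l\<^sup>2 * C / 8\<close> for every \<open>l > 0\<close>, which is then
  minimised over \<open>l\<close>.\<close>

theorem (in product_prob_space) McDiarmid_ineq_ge:
  fixes f :: "('i \<Rightarrow> 'a) \<Rightarrow> real"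
  assumes "finite I"
    and f [measurable]: "f \<in> borel_measurable (Pi\<^sub>M I M)"
    and "\<And>x. x \<in> space (Pi\<^sub>M I M) \<Longrightarrow> \<bar>f x\<bar> \<le> B"
    and "\<And>i x y. i \<in> I \<Longrightarrow> x \<in> space (Pi\<^sub>M I M) \<Longrightarrow> y \<in> space (M i) \<Longrightarrow> \<bar>f x - f (x(i := y))\<bar> \<le> c i"
    and pos: "(\<Sum>i\<in>I. (c i)\<^sup>2) > 0" and "\<epsilon> \<ge> 0"
  shows "\<P>(x in Pi\<^sub>M I M. f x \<ge> integral\<^sup>L (Pi\<^sub>M I M) f + \<epsilon>) \<le> exp (- 2 * \<epsilon>\<^sup>2 / (\<Sum>i\<in>I. (c i)\<^sup>2))"
\<comment> \<open>The minimiser is 0 when \<open>\<epsilon> = 0\<close>, which Chernoff's bound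
  excludes; the claim then only says that a probability is at most 1.\<close>
proof (cases "\<epsilon> = 0")
  case True
  show ?thesis using True by simp
next
  case False
  let ?m = "integral\<^sup>L (Pi\<^sub>M I M) f"
  define C where "C = (\<Sum>i\<in>I. (c i)\<^sup>2)"
  \<comment> \<open>The minimiser of the quadratic exponent; its minimum is
    \<open>- 2 * \<epsilon>\<^sup>2 / C\<close>.\<close>
  define l where "l = 4 * \<epsilon> / C"
  have "C > 0" "l > 0"
    using pos False \<open>\<epsilon> \<ge> 0\<close> by (auto simp: C_def l_def)
  have "ennreal (\<P>(x in Pi\<^sub>M I M. f x \<ge> ?m + \<epsilon>))
        = emeasure (Pi\<^sub>M I M) {x \<in> space (Pi\<^sub>M I M). f x - ?m \<ge> \<epsilon>}"
    by (simp add: P.emeasure_eq_measure algebra_simps)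
  also have "\<dots> \<le> ennreal (exp (- l * \<epsilon>))
                   * (\<integral>\<^sup>+x\<in>space (Pi\<^sub>M I M). exp (l * (f x - ?m)) \<partial>Pi\<^sub>M I M)"
    by (intro Chernoff_ineq_nn_integral_ge \<open>l > 0\<close>) measurable
  also have "\<dots> = ennreal (exp (- l * \<epsilon>)) * (\<integral>\<^sup>+x. exp (l * (f x - ?m)) \<partial>Pi\<^sub>M I M)"
    by (intro arg_cong2[where f = "(*)"] nn_integral_cong) simp_all
  also have "\<dots> \<le> ennreal (exp (- l * \<epsilon>)) * ennreal (exp (l\<^sup>2 * C / 8))"
    unfolding C_def by (intro mult_left_mono bounded_differences_mgf[OF assms(1) \<open>l > 0\<close> f assms(3,4)]) auto
  also have "\<dots> = ennreal (exp (- l * \<epsilon> + l\<^sup>2 * C / 8))"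
    by (simp flip: ennreal_mult exp_add)
  also have "- l * \<epsilon> + l\<^sup>2 * C / 8 = - 2 * \<epsilon>\<^sup>2 / C"
    using \<open>C > 0\<close> by (simp add: l_def field_simps power2_eq_square)
  finally show ?thesis
    by (simp add: C_def)
qed

corollary (in product_prob_space) McDiarmid_ineq_le:
  fixes f :: "('i \<Rightarrow> 'a) \<Rightarrow> real"
  assumes "finite I"
    and f [measurable]: "f \<in> borel_measurable (Pi\<^sub>M I M)"
    and "\<And>x. x \<in> space (Pi\<^sub>M I M) \<Longrightarrow> \<bar>f x\<bar> \<le> B"
    and "\<And>i x y. i \<in> I \<Longrightarrow> x \<in> space (Pi\<^sub>M I M) \<Longrightarrow> y \<in> space (M i) \<Longrightarrow> \<bar>f x - f (x(i := y))\<bar> \<le> c i"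
    and "(\<Sum>i\<in>I. (c i)\<^sup>2) > 0" and "\<epsilon> \<ge> 0"
  shows "\<P>(x in Pi\<^sub>M I M. f x \<le> integral\<^sup>L (Pi\<^sub>M I M) f - \<epsilon>) \<le> exp (- 2 * \<epsilon>\<^sup>2 / (\<Sum>i\<in>I. (c i)\<^sup>2))"
proof -
  have "\<P>(x in Pi\<^sub>M I M. - f x \<ge> integral\<^sup>L (Pi\<^sub>M I M) (\<lambda>x. - f x) + \<epsilon>)
        \<le> exp (- 2 * \<epsilon>\<^sup>2 / (\<Sum>i\<in>I. (c i)\<^sup>2))"
    using assms by (intro McDiarmid_ineq_ge[where B = B]) (auto simp: abs_minus_commute)
  moreover have "- f x \<ge> integral\<^sup>L (Pi\<^sub>M I M) (\<lambda>x. - f x) + \<epsilon> \<longleftrightarrow> f x \<le> integral\<^sup>L (Pi\<^sub>M I M) f - \<epsilon>" for x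
    by auto
  ultimately show ?thesis by simp
qed

section \<open>The weighted Hamming distance\<close>

lemma hamming_dist_nonneg:
  assumes "\<And>i. i \<in> {1..n} \<Longrightarrow> 0 \<le> \<alpha> i"
  shows "0 \<le> hamming_dist n \<alpha> x y"
  unfolding hamming_dist_def by (rule sum_nonneg) (use assms in auto)

text \<open>The coordinates where \<open>x\<close> differs from \<open>z\<close> are among those
  where \<open>x(i := y)\<close> does, together with \<open>i\<close>.\<close>

lemma hamming_dist_fun_upd_le:
  assumes "\<And>i. i \<in> {1..n} \<Longrightarrow> 0 \<le> \<alpha> i" and "i \<in> {1..n}"
  shows "hamming_dist n \<alpha> x z \<le> \<alpha> i + hamming_dist n \<alpha> (x(i := y)) z"
proof -
  let ?S = "{j\<in>{1..n}. (x(i := y)) j \<noteq> z j}"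
  have "hamming_dist n \<alpha> x z \<le> sum \<alpha> (insert i ?S)"
    unfolding hamming_dist_def by (rule sum_mono2) (use assms in auto)
  \<comment> \<open>If \<open>i\<close> already lies in \<open>?S\<close>, inserting it adds
    nothing, and the nonnegative term \<open>\<alpha> i\<close> is slack.\<close>
  also have "sum \<alpha> (insert i ?S) = (if i \<in> ?S then sum \<alpha> ?S else \<alpha> i + sum \<alpha> ?S)"
    by (rule sum.insert_if) simp
  also have "\<dots> \<le> \<alpha> i + sum \<alpha> ?S"
    using assms(1)[OF assms(2)] by simp
  finally show ?thesis
    by (simp only: hamming_dist_def)
qed

text \<open>Moving \<open>\<alpha> i\<close> to the left leaves a lower bound for each
  \<open>z\<close> in \<open>A\<close>, so the infimum can be taken. Truncated subtraction loses
  nothing because \<open>\<alpha> i\<close> is finite, and the argument covers empty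
  \<open>A\<close> as well.\<close>

lemma hamming_dist_set_fun_upd_le:
  assumes "\<And>i. i \<in> {1..n} \<Longrightarrow> 0 \<le> \<alpha> i" and "i \<in> {1..n}"
  shows "hamming_dist_set n \<alpha> x A \<le> ennreal (\<alpha> i) + hamming_dist_set n \<alpha> (x(i := y)) A"
proof -
  have "hamming_dist_set n \<alpha> x A - ennreal (\<alpha> i) \<le> hamming_dist_set n \<alpha> (x(i := y)) A"
    unfolding hamming_dist_set_def[of _ _ "x(i := y)"]
  proof (rule INF_greatest)
    fix z assume z: "z \<in> A"
    have "hamming_dist_set n \<alpha> x A \<le> ennreal (hamming_dist n \<alpha> x z)"
      unfolding hamming_dist_set_def using z by (rule INF_lower)
    also have "\<dots> \<le> ennreal (\<alpha> i) + ennreal (hamming_dist n \<alpha> (x(i := y)) z)"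
      using hamming_dist_fun_upd_le[of n \<alpha> i x z y] assms hamming_dist_nonneg[of n \<alpha>]
      by (subst ennreal_plus [symmetric]) (auto intro!: ennreal_leI)
    finally show "hamming_dist_set n \<alpha> x A - ennreal (\<alpha> i) \<le> ennreal (hamming_dist n \<alpha> (x(i := y)) z)"
      by (simp add: ennreal_minus_le_iff)
  qed
  then show ?thesis
    by (simp add: ennreal_minus_le_iff)
qed

lemma hamming_dist_set_eq_0:
  assumes "x \<in> A"
  shows "hamming_dist_set n \<alpha> x A = 0"
proof -
  have "hamming_dist_set n \<alpha> x A \<le> ennreal (hamming_dist n \<alpha> x x)"
    unfolding hamming_dist_set_def using assms by (rule INF_lower)
  then show ?thesis by (simp add: hamming_dist_def)
qed

text \<open>For nonempty \<open>A\<close> this makes the distance finite and uniformly bounded, so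
  it can be treated as a bounded real function.\<close>

lemma hamming_dist_set_le_sum:
  assumes "A \<noteq> {}" and "\<And>i. i \<in> {1..n} \<Longrightarrow> 0 \<le> \<alpha> i"
  shows "hamming_dist_set n \<alpha> x A \<le> ennreal (\<Sum>i\<in>{1..n}. \<alpha> i)"
proof -
  obtain y where "y \<in> A" using assms by auto
  then have "hamming_dist_set n \<alpha> x A \<le> ennreal (hamming_dist n \<alpha> x y)"
    unfolding hamming_dist_set_def by (rule INF_lower)
  also have "\<dots> \<le> ennreal (\<Sum>i\<in>{1..n}. \<alpha> i)"
    unfolding hamming_dist_def using assms by (intro ennreal_leI sum_mono2) auto
  finally show ?thesis .
qed

text \<open>By independence the law of \<open>X\<close> is a product measure, on which the distance
  to \<open>A\<close> has differences at most \<open>\<alpha> i\<close>. The squares of these sum to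
  1, so McDiarmid's exponent has no denominator left.\<close>

lemma
  fixes X :: "'a \<Rightarrow> nat \<Rightarrow> 'e"
  assumes "prob_space M" and n: "n \<ge> 1"
    and X [measurable]: "X \<in> M \<rightarrow>\<^sub>M (\<Pi>\<^sub>M i\<in>{1..n}. E)"
    and indep: "prob_space.indep_vars M (\<lambda>_. E) (\<lambda>i \<omega>. X \<omega> i) {1..n}"
    and \<alpha>: "\<And>i. i \<in> {1..n} \<Longrightarrow> 0 \<le> \<alpha> i" and L2: "L2_set \<alpha> {1..n} = 1"
    and "A \<noteq> {}"
    and D [measurable]: "(\<lambda>x. hamming_dist_set n \<alpha> x A) \<in> borel_measurable (\<Pi>\<^sub>M i\<in>{1..n}. E)"
    and "\<epsilon> \<ge> 0"
  defines "d \<equiv> \<lambda>\<omega>. enn2real (hamming_dist_set n \<alpha> (X \<omega>) A)"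
  shows hamming_dist_set_ge: "\<P>(\<omega> in M. d \<omega> \<ge> integral\<^sup>L M d + \<epsilon>) \<le> exp (- 2 * \<epsilon>\<^sup>2)"
    and hamming_dist_set_le: "\<P>(\<omega> in M. d \<omega> \<le> integral\<^sup>L M d - \<epsilon>) \<le> exp (- 2 * \<epsilon>\<^sup>2)"
proof -
  interpret prob_space M by fact
  define f where "f = (\<lambda>x. enn2real (hamming_dist_set n \<alpha> x A))"
  \<comment> \<open>A probability measure is required at every index, also outside
    \<open>{1..n}\<close>; there the law of coordinate 1 is a filler, available since
    \<open>n \<ge> 1\<close>.\<close>
  define N where "N = (\<lambda>i. distr M E (\<lambda>\<omega>. X \<omega> (if i \<in> {1..n} then i else 1)))"
  let ?P = "Pi\<^sub>M {1..n} N"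
  have comp [measurable]: "(\<lambda>\<omega>. X \<omega> i) \<in> M \<rightarrow>\<^sub>M E" if "i \<in> {1..n}" for i
    using measurable_compose[OF X measurable_component_singleton[OF that]] .
  interpret N: product_prob_space N "{1..n}"
  proof (rule product_prob_spaceI)
    show "prob_space (N i)" for i
      unfolding N_def by (rule prob_space_distr) (use n in \<open>auto intro!: comp\<close>)
  qed
  have distr_X: "distr M (\<Pi>\<^sub>M i\<in>{1..n}. E) X = ?P"
  proof -
    \<comment> \<open>Values of \<open>X\<close> are extensional functions, hence equal to their
      restrictions to \<open>{1..n}\<close>.\<close>
    have "distr M (\<Pi>\<^sub>M i\<in>{1..n}. E) X = distr M (\<Pi>\<^sub>M i\<in>{1..n}. E) (\<lambda>\<omega>. \<lambda>i\<in>{1..n}. X \<omega> i)"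
      using measurable_space[OF X]
      by (intro distr_cong) (auto simp: space_PiM PiE_def extensional_restrict)
    also have "\<dots> = (\<Pi>\<^sub>M i\<in>{1..n}. distr M E (\<lambda>\<omega>. X \<omega> i))"
      using indep_vars_iff_distr_eq_PiM'[of "{1..n}" "\<lambda>i \<omega>. X \<omega> i" "\<lambda>_. E"] indep comp n by auto
    also have "\<dots> = ?P"
      by (intro PiM_cong) (auto simp: N_def)
    finally show ?thesis .
  qed
  have sets_P [measurable_cong]: "sets ?P = sets (\<Pi>\<^sub>M i\<in>{1..n}. E)"
    using distr_X by (metis sets_distr)
  have f [measurable]: "f \<in> borel_measurable (\<Pi>\<^sub>M i\<in>{1..n}. E)"
    unfolding f_def by measurable
  have f_P: "f \<in> borel_measurable ?P"
    using f by (simp only: measurable_cong_sets[OF sets_P refl])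
  have mean: "integral\<^sup>L ?P f = integral\<^sup>L M d"
    using integral_distr[OF X f] unfolding distr_X by (simp add: d_def f_def)
  \<comment> \<open>An event about \<open>f\<close> under the law of \<open>X\<close> has the same
    probability as the corresponding event about \<open>d\<close> under \<open>M\<close>.\<close>
  have transfer: "\<P>(x in ?P. Q (f x)) = \<P>(\<omega> in M. Q (d \<omega>))"
    if [measurable]: "Measurable.pred borel Q" for Q
  proof -
    have "\<P>(x in ?P. Q (f x)) = prob (X -` {x \<in> space (\<Pi>\<^sub>M i\<in>{1..n}. E). Q (f x)} \<inter> space M)"
      unfolding distr_X [symmetric] space_distr by (rule measure_distr[OF X]) measurable
    also have "\<dots> = \<P>(\<omega> in M. Q (d \<omega>))"
      using measurable_space[OF X] by (intro arg_cong[where f = prob]) (auto simp: f_def d_def)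
    finally show ?thesis .
  qed
  have fin: "hamming_dist_set n \<alpha> x A < top" for x
    using hamming_dist_set_le_sum[OF \<open>A \<noteq> {}\<close> \<alpha>, of n "\<lambda>i. i" x] by (rule le_less_trans) auto
  have bdd: "\<bar>f x\<bar> \<le> (\<Sum>i\<in>{1..n}. \<alpha> i)" for x
    using hamming_dist_set_le_sum[OF \<open>A \<noteq> {}\<close> \<alpha>, of n "\<lambda>i. i" x] \<alpha>
    by (auto simp: f_def intro!: enn2real_leI sum_nonneg)
  have lip: "f x \<le> \<alpha> i + f (x(i := y))" if i: "i \<in> {1..n}" for i x y
  proof -
    have "f x \<le> enn2real (ennreal (\<alpha> i) + hamming_dist_set n \<alpha> (x(i := y)) A)"
      unfolding f_def using hamming_dist_set_fun_upd_le[OF \<alpha> i] fin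
      by (intro enn2real_mono) auto
    also have "\<dots> = \<alpha> i + f (x(i := y))"
      using fin \<alpha>[OF i] by (simp add: f_def enn2real_plus)
    finally show ?thesis .
  qed
  \<comment> \<open>The second use of \<open>lip\<close> undoes the update by writing back
    \<open>x i\<close>, which gives the reverse inequality.\<close>
  have diff: "\<bar>f x - f (x(i := y))\<bar> \<le> \<alpha> i" if i: "i \<in> {1..n}" for i x y
    using lip[OF i, of x y] lip[OF i, of "x(i := y)" "x i"] by auto
  have sq: "(\<Sum>i\<in>{1..n}. (\<alpha> i)\<^sup>2) = 1"
    using L2 by (simp add: L2_set_def)
  have "\<P>(x in ?P. f x \<ge> integral\<^sup>L ?P f + \<epsilon>) \<le> exp (- 2 * \<epsilon>\<^sup>2 / (\<Sum>i\<in>{1..n}. (\<alpha> i)\<^sup>2))"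
    by (rule N.McDiarmid_ineq_ge[OF _ f_P bdd diff]) (use sq \<open>\<epsilon> \<ge> 0\<close> in auto)
  moreover have "\<P>(x in ?P. f x \<ge> integral\<^sup>L ?P f + \<epsilon>) = \<P>(\<omega> in M. d \<omega> \<ge> integral\<^sup>L M d + \<epsilon>)"
    unfolding mean by (rule transfer) measurable
  ultimately show "\<P>(\<omega> in M. d \<omega> \<ge> integral\<^sup>L M d + \<epsilon>) \<le> exp (- 2 * \<epsilon>\<^sup>2)"
    unfolding sq by simp
  have "\<P>(x in ?P. f x \<le> integral\<^sup>L ?P f - \<epsilon>) \<le> exp (- 2 * \<epsilon>\<^sup>2 / (\<Sum>i\<in>{1..n}. (\<alpha> i)\<^sup>2))"
    by (rule N.McDiarmid_ineq_le[OF _ f_P bdd diff]) (use sq \<open>\<epsilon> \<ge> 0\<close> in auto)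
  moreover have "\<P>(x in ?P. f x \<le> integral\<^sup>L ?P f - \<epsilon>) = \<P>(\<omega> in M. d \<omega> \<le> integral\<^sup>L M d - \<epsilon>)"
    unfolding mean by (rule transfer) measurable
  ultimately show "\<P>(\<omega> in M. d \<omega> \<le> integral\<^sup>L M d - \<epsilon>) \<le> exp (- 2 * \<epsilon>\<^sup>2)"
    unfolding sq by simp
qed

section \<open>Combining the two tails\<close>

lemma exp_neg_ennreal:
  "x \<ge> 0 \<Longrightarrow> exp_neg (ennreal x) = exp (- x)"
  by (simp add: exp_neg_def)

theorem theorem2p1:
  fixes M :: "'a measure" and E :: "'e measure" and n :: nat
    and X :: "'a \<Rightarrow> nat \<Rightarrow> 'e" and \<alpha> :: "nat \<Rightarrow> real"
    and A :: "(nat \<Rightarrow> 'e) set" and \<rho> :: ennreal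
  assumes "prob_space M"
    and "n \<ge> 1"
    and "X \<in> M \<rightarrow>\<^sub>M (\<Pi>\<^sub>M i\<in>{1..n}. E)"
    and "prob_space.indep_vars M (\<lambda>_. E) (\<lambda>i \<omega>. X \<omega> i) {1..n}"
    and "\<And>i. i \<in> {1..n} \<Longrightarrow> 0 \<le> \<alpha> i"
    and "L2_set \<alpha> {1..n} = 1"
    and "A \<in> sets (\<Pi>\<^sub>M i\<in>{1..n}. E)"
    and "(\<lambda>x. hamming_dist_set n \<alpha> x A) \<in> borel_measurable (\<Pi>\<^sub>M i\<in>{1..n}. E)"
    and "\<rho> = (\<integral>\<^sup>+ \<omega>. hamming_dist_set n \<alpha> (X \<omega>) A \<partial>M)"
  shows "(\<forall>t::real. t > 0 \<longrightarrow>
            \<P>(\<omega> in M. hamming_dist_set n \<alpha> (X \<omega>) A \<ge> ennreal t) * \<P>(\<omega> in M. X \<omega> \<in> A)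
              \<le> exp_neg (rate \<rho> t))
       \<and> (\<forall>t::real. t > 0 \<longrightarrow>
            \<P>(\<omega> in M. hamming_dist_set n \<alpha> (X \<omega>) A \<ge> ennreal t) * \<P>(\<omega> in M. X \<omega> \<in> A)
              \<le> exp (- t\<^sup>2))
       \<and> \<P>(\<omega> in M. X \<omega> \<notin> A) * \<P>(\<omega> in M. X \<omega> \<in> A) \<le> exp_neg (2 * \<rho>\<^sup>2)"
proof (cases "A = {}")
  \<comment> \<open>Here \<open>X \<in> A\<close> has probability 0, so every left-hand side
    vanishes.\<close>
  case True
  then show ?thesis by (simp add: exp_neg_def)
next
  case False
  interpret prob_space M by fact
  note [measurable] = assms(3,7,8)
  define d where "d = (\<lambda>\<omega>. enn2real (hamming_dist_set n \<alpha> (X \<omega>) A))"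
  define r where "r = integral\<^sup>L M d"
  have d [measurable]: "d \<in> borel_measurable M"
    unfolding d_def by measurable
  have le_sum: "hamming_dist_set n \<alpha> x A \<le> ennreal (\<Sum>i\<in>{1..n}. \<alpha> i)" for x
    using hamming_dist_set_le_sum[OF False assms(5)] .
  have D_eq: "hamming_dist_set n \<alpha> (X \<omega>) A = ennreal (d \<omega>)" for \<omega>
    unfolding d_def using le_sum[of "X \<omega>"] by (simp add: ennreal_enn2real le_less_trans)
  have d_nonneg: "d \<omega> \<ge> 0" for \<omega>
    by (simp add: d_def)
  have d_le: "d \<omega> \<le> (\<Sum>i\<in>{1..n}. \<alpha> i)" for \<omega>
    using le_sum[of "X \<omega>"] assms(5) by (auto simp: d_def intro!: enn2real_leI sum_nonneg)
  have "integrable M d"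
    by (rule integrable_const_bound[where B = "\<Sum>i\<in>{1..n}. \<alpha> i"]) (use d_nonneg d_le in auto)
  \<comment> \<open>Boundedness of \<open>d\<close> makes the extended mean finite; from here on
    everything can be computed with the real mean \<open>r\<close>.\<close>
  then have \<rho>: "\<rho> = ennreal r"
    unfolding assms(9) r_def D_eq using d_nonneg by (intro nn_integral_eq_integral) auto
  have "r \<ge> 0"
    unfolding r_def using d_nonneg by simp
  have upper: "\<P>(\<omega> in M. d \<omega> \<ge> t) \<le> exp (- 2 * (t - r)\<^sup>2)" if "t \<ge> r" for t
    using hamming_dist_set_ge[OF assms(1-6) False assms(8), of "t - r"] that
    by (simp add: d_def r_def)
  have lower: "\<P>(\<omega> in M. X \<omega> \<in> A) \<le> exp (- 2 * r\<^sup>2)"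
  proof -
    \<comment> \<open>On \<open>A\<close> the distance is 0, a deviation of exactly \<open>r\<close>
      below the mean, so the lower tail is used with \<open>\<epsilon> = r\<close>.\<close>
    have "\<P>(\<omega> in M. X \<omega> \<in> A) \<le> \<P>(\<omega> in M. d \<omega> \<le> 0)"
      by (intro finite_measure_mono) (auto simp: d_def hamming_dist_set_eq_0)
    also have "\<dots> \<le> exp (- 2 * r\<^sup>2)"
      using hamming_dist_set_le[OF assms(1-6) False assms(8) \<open>r \<ge> 0\<close>]
      by (simp add: d_def r_def)
    finally show ?thesis .
  qed
  have rate_eq: "rate \<rho> t = ennreal (if t < r then 2 * r\<^sup>2 else t\<^sup>2 + (t - 2 * r)\<^sup>2)" if "t > 0" for t
    using that \<open>r \<ge> 0\<close>
    by (auto simp: rate_def \<rho> ennreal_less_iff ennreal_mult ennreal_power)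
  have main: "\<P>(\<omega> in M. hamming_dist_set n \<alpha> (X \<omega>) A \<ge> ennreal t) * \<P>(\<omega> in M. X \<omega> \<in> A)
      \<le> exp_neg (rate \<rho> t)" if "t > 0" for t
  proof -
    have "\<P>(\<omega> in M. d \<omega> \<ge> t) * \<P>(\<omega> in M. X \<omega> \<in> A) \<le> exp_neg (rate \<rho> t)"
    proof (cases "t < r")
      case True
      \<comment> \<open>Below the mean the upper tail gives no information, and its probability is
        bounded by 1.\<close>
      have "\<P>(\<omega> in M. d \<omega> \<ge> t) * \<P>(\<omega> in M. X \<omega> \<in> A) \<le> 1 * exp (- 2 * r\<^sup>2)"
        by (intro mult_mono lower) auto
      then show ?thesis
        using True by (simp add: rate_eq[OF that] exp_neg_ennreal del: ennreal_plus)
    next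
      case False
      have "\<P>(\<omega> in M. d \<omega> \<ge> t) * \<P>(\<omega> in M. X \<omega> \<in> A) \<le> exp (- 2 * (t - r)\<^sup>2) * exp (- 2 * r\<^sup>2)"
        using False by (intro mult_mono lower upper) auto
      also have "\<dots> = exp (- (t\<^sup>2 + (t - 2 * r)\<^sup>2))"
        by (simp add: power2_eq_square algebra_simps flip: exp_add)
      finally show ?thesis
        using False by (simp add: rate_eq[OF that] exp_neg_ennreal del: ennreal_plus)
    qed
    then show ?thesis
      using that d_nonneg by (simp add: D_eq)
  qed
  moreover have "exp_neg (rate \<rho> t) \<le> exp (- t\<^sup>2)" if "t > 0" for t
  \<comment> \<open>The rate dominates \<open>t\<^sup>2\<close> in both branches: for
    \<open>t < r\<close> through \<open>t\<^sup>2 \<le> r\<^sup>2\<close>, and otherwise because it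
    is \<open>t\<^sup>2\<close> plus a square.\<close>
  proof (cases "t < r")
    case True
    then have "t\<^sup>2 \<le> r\<^sup>2"
      using that by (intro power_mono) auto
    then have "t\<^sup>2 \<le> 2 * r\<^sup>2"
      using zero_le_power2[of r] by linarith
    then show ?thesis
      using True by (simp add: rate_eq[OF that] exp_neg_ennreal del: ennreal_plus)
  qed (simp add: rate_eq[OF that] exp_neg_ennreal del: ennreal_plus)
  moreover have "\<P>(\<omega> in M. X \<omega> \<notin> A) * \<P>(\<omega> in M. X \<omega> \<in> A) \<le> exp_neg (2 * \<rho>\<^sup>2)"
  proof -
    \<comment> \<open>The lower tail alone suffices, with no limit \<open>t \<rightarrow> 0\<close>
      in the first claim.\<close>
    have "\<P>(\<omega> in M. X \<omega> \<notin> A) * \<P>(\<omega> in M. X \<omega> \<in> A) \<le> 1 * exp (- 2 * r\<^sup>2)"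
      by (intro mult_mono lower) auto
    moreover have "2 * \<rho>\<^sup>2 = ennreal (2 * r\<^sup>2)"
      using \<open>r \<ge> 0\<close> by (simp add: \<rho> ennreal_mult ennreal_power)
    ultimately show ?thesis
      by (simp add: exp_neg_ennreal)
  qed
  ultimately show ?thesis
    by (meson order_trans)
qed

end
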